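(* Let $\mathbb K$ be a field, let $\alpha=\sum_{k=-\infty}^{\infty}\alpha_kx^k\in\mathbb L$ and $\beta=\sum_{k=-\infty}^{\infty}\beta_kx^k\in\mathbb L$, and let $\mathbf v=[\ldots,\beta_{-1},\beta_0,\beta_1,\ldots]^T$ be the bi-infinite column vector of coefficients of $\beta$. Let $\mathbf A_\alpha=[\alpha_{i-j}]_{i,j\in\mathbb Z}$. (a) If $\alpha,\beta\in\mathbb K((x))$, then $\mathbf A_\alpha\mathbf v$ is well defined. (b) If $\alpha,\beta\in\mathbb K((\frac1x))$, then $\mathbf A_\alpha\mathbf v$ is well defined. In any other case the product is not necessarily well defined (i.e. outside cases (a) and (b), $\mathbf A_\alpha\mathbf v$ can fail to be well defined). Moreover, in cases (a) and (b), if $\mathbf w=[\ldots,w_{-1},w_0,w_1,\ldots]^T=\mathbf A_\alpha\mathbf v$ and $\gamma=\sum_{k=-\infty}^{\infty}w_kx^k$, then $\gamma=\alpha\cdot\beta$.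
   Context: $\mathbb L$ is the set of formal Laurent series $\sum_{k=-\infty}^{\infty}\omega_kx^k$ with $\omega_k\in\mathbb K$ (infinitely many nonzero coefficients allowed in both directions). $\mathbb K((x))\subset\mathbb L$ consists of those series for which there is $n\in\mathbb Z$ with $\omega_k=0$ for all $k<n$; $\mathbb K((\frac1x))\subset\mathbb L$ consists of those for which there is $n\in\mathbb Z$ with $\omega_k=0$ for all $k>n$. The product $\alpha\cdot\beta$ of two series in $\mathbb L$ is the series with $k$-th coefficient $\sum_{i+j=k}\alpha_i\beta_j$; it is defined when for each $k$ only finitely many terms of this sum are nonzero. A bi-infinite matrix is an array $\mathbf M=[m_{ij}]_{i,j\in\mathbb Z}$ with entries in $\mathbb K$ ($i$ the row index, $j$ the column index). For a bi-infinite column vector $\mathbf v=[\ldots,v_{-1},v_0,v_1,\ldots]^T$, the product $\mathbf M\mathbf v$ is the vector with entries $w_i=\sum_{j\in\mathbb Z}m_{ij}v_j$; it is well defined if and only if for every $i$ only finitely many of the products $m_{ij}v_j$ are nonzero. *)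

theory Defs
  imports Main
begin

text \<open>Formal Laurent series that may be infinite in both directions. As for formal power series,
  there is no condition on the coefficients; the type is kept apart from that of bi-infinite
  vectors \<open>int \<Rightarrow> 'a\<close>.\<close>

typedef 'a bilaurent = "UNIV :: (int \<Rightarrow> 'a) set"
  morphisms bl_coeff series
  by simp

definition laurent_x :: "'a::zero bilaurent set" where
  "laurent_x = {\<omega>. \<exists>n. \<forall>k<n. bl_coeff \<omega> k = 0}"

definition laurent_inv_x :: "'a::zero bilaurent set" where
  "laurent_inv_x = {\<omega>. \<exists>n. \<forall>k>n. bl_coeff \<omega> k = 0}"

definition conv_support :: "'a::semiring_0 bilaurent \<Rightarrow> 'a bilaurent \<Rightarrow> int \<Rightarrow> (int \<times> int) set" where
  "conv_support \<alpha> \<beta> k = {(i, j). i + j = k \<and> bl_coeff \<alpha> i * bl_coeff \<beta> j \<noteq> 0}"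

definition bl_times_defined :: "'a::semiring_0 bilaurent \<Rightarrow> 'a bilaurent \<Rightarrow> bool" where
  "bl_times_defined \<alpha> \<beta> \<longleftrightarrow> (\<forall>k. finite (conv_support \<alpha> \<beta> k))"

text \<open>Meaningful only under \<open>bl_times_defined\<close>; a sum over an infinite set is \<open>0\<close>.\<close>

definition bl_times :: "'a::semiring_0 bilaurent \<Rightarrow> 'a bilaurent \<Rightarrow> 'a bilaurent" where
  "bl_times \<alpha> \<beta> =
     series (\<lambda>k. \<Sum>(i, j)\<in>conv_support \<alpha> \<beta> k. bl_coeff \<alpha> i * bl_coeff \<beta> j)"

text \<open>Bi-infinite matrices are functions of the row index and then the column index.\<close>

definition mat_vec_defined :: "(int \<Rightarrow> int \<Rightarrow> 'a::semiring_0) \<Rightarrow> (int \<Rightarrow> 'a) \<Rightarrow> bool" where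
  "mat_vec_defined M v \<longleftrightarrow> (\<forall>i. finite {j. M i j * v j \<noteq> 0})"

text \<open>Meaningful only under \<open>mat_vec_defined\<close>.\<close>

definition mat_vec :: "(int \<Rightarrow> int \<Rightarrow> 'a::semiring_0) \<Rightarrow> (int \<Rightarrow> 'a) \<Rightarrow> int \<Rightarrow> 'a" where
  "mat_vec M v = (\<lambda>i. \<Sum>j | M i j * v j \<noteq> 0. M i j * v j)"

definition series_matrix :: "'a bilaurent \<Rightarrow> int \<Rightarrow> int \<Rightarrow> 'a" where
  "series_matrix \<alpha> = (\<lambda>i j. bl_coeff \<alpha> (i - j))"

end

theory Submission
  imports Defs
begin

text \<open>Row \<open>k\<close> of \<open>A\<^sub>\<alpha> v\<close> and the \<open>k\<close>-th coefficient of \<open>\<alpha> \<cdot> \<beta>\<close> have the same terms, indexed by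
  \<open>j\<close> and by the pairs \<open>(k - j, j)\<close>, so the two products agree whatever \<open>\<alpha>\<close> and \<open>\<beta>\<close> are. In cases
  (a) and (b) the relevant \<open>j\<close> lie in a bounded interval. Otherwise, failure is witnessed by the
  series with all coefficients \<open>1\<close> on the nonnegative, on the nonpositive, or on all integers: only
  the first paired with itself, or the second paired with itself, has a well-defined product.\<close>

lemma conv_support_eq_image:
  "conv_support \<alpha> \<beta> k = (\<lambda>j. (k - j, j)) ` {j. series_matrix \<alpha> k j * bl_coeff \<beta> j \<noteq> 0}"
  by (force simp: conv_support_def series_matrix_def)

text \<open>A pair with sum \<open>k\<close> is determined by its second entry, so the reindexing
  map is injective and finiteness transfers in both directions.\<close>

lemma bl_times_defined_iff_mat_vec_defined:
  "bl_times_defined \<alpha> \<beta> \<longleftrightarrow> mat_vec_defined (series_matrix \<alpha>) (bl_coeff \<beta>)"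
  unfolding bl_times_defined_def mat_vec_defined_def conv_support_eq_image
  by (subst finite_image_iff) (auto intro: inj_onI)

lemma bl_times_eq_mat_vec:
  "bl_times \<alpha> \<beta> = series (mat_vec (series_matrix \<alpha>) (bl_coeff \<beta>))"
proof -
  have "(\<Sum>(i, j)\<in>conv_support \<alpha> \<beta> k. bl_coeff \<alpha> i * bl_coeff \<beta> j)
    = mat_vec (series_matrix \<alpha>) (bl_coeff \<beta>) k" for k
    unfolding conv_support_eq_image mat_vec_def
    by (subst sum.reindex) (auto intro: inj_onI simp: series_matrix_def)
  then show ?thesis
    unfolding bl_times_def by simp
qed

lemma mat_vec_defined_laurent_x:
  assumes "\<alpha> \<in> laurent_x" and "\<beta> \<in> laurent_x"
  shows "mat_vec_defined (series_matrix \<alpha>) (bl_coeff \<beta>)"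
proof -
  obtain m n where m: "\<And>k. k < m \<Longrightarrow> bl_coeff \<alpha> k = 0" and n: "\<And>k. k < n \<Longrightarrow> bl_coeff \<beta> k = 0"
    using assms by (auto simp: laurent_x_def)
  \<comment> \<open>A nonzero product needs two nonzero factors: the first forces
    \<open>j \<le> i - m\<close>, the second \<open>n \<le> j\<close>.\<close>
  have "{j. bl_coeff \<alpha> (i - j) * bl_coeff \<beta> j \<noteq> 0} \<subseteq> {n..i - m}" for i
  proof
    fix j assume "j \<in> {j. bl_coeff \<alpha> (i - j) * bl_coeff \<beta> j \<noteq> 0}"
    then have "\<not> i - j < m" "\<not> j < n"
      using m n by force+
    then show "j \<in> {n..i - m}" by simp
  qed
  then show ?thesis
    unfolding mat_vec_defined_def series_matrix_def
    by (meson finite_atLeastAtMost_int finite_subset)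
qed

lemma mat_vec_defined_laurent_inv_x:
  assumes "\<alpha> \<in> laurent_inv_x" and "\<beta> \<in> laurent_inv_x"
  shows "mat_vec_defined (series_matrix \<alpha>) (bl_coeff \<beta>)"
proof -
  obtain m n where m: "\<And>k. k > m \<Longrightarrow> bl_coeff \<alpha> k = 0" and n: "\<And>k. k > n \<Longrightarrow> bl_coeff \<beta> k = 0"
    using assms by (auto simp: laurent_inv_x_def)
  have "{j. bl_coeff \<alpha> (i - j) * bl_coeff \<beta> j \<noteq> 0} \<subseteq> {i - m..n}" for i
  proof
    fix j assume "j \<in> {j. bl_coeff \<alpha> (i - j) * bl_coeff \<beta> j \<noteq> 0}"
    then have "\<not> i - j > m" "\<not> j > n"
      using m n by force+
    then show "j \<in> {i - m..n}" by simp
  qed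
  then show ?thesis
    unfolding mat_vec_defined_def series_matrix_def
    by (meson finite_atLeastAtMost_int finite_subset)
qed

definition indicator_series :: "int set \<Rightarrow> 'a::zero_neq_one bilaurent" where
  "indicator_series A = series (\<lambda>k. of_bool (k \<in> A))"

lemma bl_coeff_indicator_series [simp]: "bl_coeff (indicator_series A) k = of_bool (k \<in> A)"
  by (simp add: indicator_series_def series_inverse)

text \<open>Row 0 alone already fails: its terms are 1 exactly where \<open>- j \<in> A\<close> and
  \<open>j \<in> B\<close>.\<close>

lemma not_mat_vec_defined_indicator_series:
  assumes "infinite {j. - j \<in> A \<and> j \<in> B}"
  shows "\<not> mat_vec_defined (series_matrix (indicator_series A :: 'a::semiring_1 bilaurent))
    (bl_coeff (indicator_series B))"
proof -
  have "{j. series_matrix (indicator_series A :: 'a bilaurent) 0 j * bl_coeff (indicator_series B) j \<noteq> 0}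
      = {j. - j \<in> A \<and> j \<in> B}"
    by (auto simp: series_matrix_def)
  with assms show ?thesis
    unfolding mat_vec_defined_def by metis
qed

lemma indicator_series_in_laurent_x_iff:
  "(indicator_series A :: 'a::zero_neq_one bilaurent) \<in> laurent_x \<longleftrightarrow> (\<exists>n. A \<subseteq> {n..})"
  unfolding laurent_x_def mem_Collect_eq bl_coeff_indicator_series of_bool_eq_0_iff
  by (simp add: subset_iff flip: not_less) blast

lemma indicator_series_in_laurent_inv_x_iff:
  "(indicator_series A :: 'a::zero_neq_one bilaurent) \<in> laurent_inv_x \<longleftrightarrow> (\<exists>n. A \<subseteq> {..n})"
  unfolding laurent_inv_x_def mem_Collect_eq bl_coeff_indicator_series of_bool_eq_0_iff
  by (simp add: subset_iff flip: not_less) blast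

lemma not_subset_atLeast_int: "\<not> UNIV \<subseteq> {n::int..}" "\<not> {..m} \<subseteq> {n::int..}"
proof -
  \<comment> \<open>An integer below both \<open>m\<close> and \<open>n\<close> refutes the two
    inclusions at once.\<close>
  have "min m n - 1 \<in> {..m} - {n..}" by auto
  then show "\<not> UNIV \<subseteq> {n..}" "\<not> {..m} \<subseteq> {n..}" by blast+
qed

lemma not_subset_atMost_int: "\<not> UNIV \<subseteq> {..n::int}" "\<not> {m..} \<subseteq> {..n::int}"
proof -
  have "max m n + 1 \<in> {m..} - {..n}" by auto
  then show "\<not> UNIV \<subseteq> {..n}" "\<not> {m..} \<subseteq> {..n}" by blast+
qed

text \<open>Failure is claimed for pairs of classes, since a single pair outside (a) and (b) may
  still have a product, for instance when one series is 0.\<close>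

theorem theorem10:
  fixes \<alpha> \<beta> :: "'a::field bilaurent" and v :: "int \<Rightarrow> 'a"
  assumes "v = bl_coeff \<beta>"
  shows "(\<alpha> \<in> laurent_x \<and> \<beta> \<in> laurent_x \<longrightarrow> mat_vec_defined (series_matrix \<alpha>) v) \<and>
    (\<alpha> \<in> laurent_inv_x \<and> \<beta> \<in> laurent_inv_x \<longrightarrow> mat_vec_defined (series_matrix \<alpha>) v) \<and>
    (let \<C> = {laurent_x, laurent_inv_x, UNIV,
              laurent_x - laurent_inv_x, laurent_inv_x - laurent_x,
              - (laurent_x \<union> laurent_inv_x)} :: 'a bilaurent set set
     in \<forall>S\<in>\<C>. \<forall>T\<in>\<C>.
       \<not> (S \<subseteq> laurent_x \<and> T \<subseteq> laurent_x) \<and> \<not> (S \<subseteq> laurent_inv_x \<and> T \<subseteq> laurent_inv_x) \<longrightarrow>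
       (\<exists>\<alpha>'\<in>S. \<exists>\<beta>'\<in>T. \<not> mat_vec_defined (series_matrix \<alpha>') (bl_coeff \<beta>'))) \<and>
    (\<forall>w \<gamma>.
       (\<alpha> \<in> laurent_x \<and> \<beta> \<in> laurent_x \<or> \<alpha> \<in> laurent_inv_x \<and> \<beta> \<in> laurent_inv_x) \<and>
       w = mat_vec (series_matrix \<alpha>) v \<and> \<gamma> = series w \<longrightarrow>
       bl_times_defined \<alpha> \<beta> \<and> \<gamma> = bl_times \<alpha> \<beta>)"
proof -
  let ?\<C> = "{laurent_x, laurent_inv_x, UNIV,
    laurent_x - laurent_inv_x, laurent_inv_x - laurent_x,
    - (laurent_x \<union> laurent_inv_x)} :: 'a bilaurent set set"
  let ?P = "indicator_series {0..} :: 'a bilaurent"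
  let ?N = "indicator_series {..0} :: 'a bilaurent"
  let ?U = "indicator_series UNIV :: 'a bilaurent"
  note mem = indicator_series_in_laurent_x_iff indicator_series_in_laurent_inv_x_iff
    not_subset_atLeast_int not_subset_atMost_int
  have "?P \<in> laurent_x - laurent_inv_x" "?N \<in> laurent_inv_x - laurent_x"
    "?U \<in> - (laurent_x \<union> laurent_inv_x)"
    by (auto simp: mem simp del: atLeast_subset_iff atMost_subset_iff)
  \<comment> \<open>Three series serve all six classes: \<open>?P\<close> lies in the two classes
    inside \<open>laurent_x\<close>, \<open>?N\<close> in the two inside
    \<open>laurent_inv_x\<close>, and \<open>?U\<close> in the other two.\<close>
  then have witness: "S \<subseteq> laurent_x \<and> ?P \<in> S \<or> S \<subseteq> laurent_inv_x \<and> ?N \<in> S \<or> ?U \<in> S"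
    if "S \<in> ?\<C>" for S
    using that by blast
  have "{j::int. - j \<in> {0..} \<and> j \<in> {..0}} = {..0}" "{j::int. - j \<in> {..0} \<and> j \<in> {0..}} = {0..}"
    "{j::int. - j \<in> {0..}} = {..0}" "{j::int. - j \<in> {..0}} = {0..}"
    by auto
  \<comment> \<open>These are all ordered pairs of witnesses except \<open>?P\<close> with itself
    and \<open>?N\<close> with itself.\<close>
  then have undef:
    "\<not> mat_vec_defined (series_matrix ?P) (bl_coeff ?N)"
    "\<not> mat_vec_defined (series_matrix ?N) (bl_coeff ?P)"
    "\<not> mat_vec_defined (series_matrix ?U) (bl_coeff ?P)"
    "\<not> mat_vec_defined (series_matrix ?U) (bl_coeff ?N)"
    "\<not> mat_vec_defined (series_matrix ?U) (bl_coeff ?U)"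
    "\<not> mat_vec_defined (series_matrix ?P) (bl_coeff ?U)"
    "\<not> mat_vec_defined (series_matrix ?N) (bl_coeff ?U)"
    by (intro not_mat_vec_defined_indicator_series;
        simp add: infinite_Ici infinite_Iic infinite_UNIV_int)+
  have fails: "\<exists>\<alpha>'\<in>S. \<exists>\<beta>'\<in>T. \<not> mat_vec_defined (series_matrix \<alpha>') (bl_coeff \<beta>')"
    if "S \<in> ?\<C>" "T \<in> ?\<C>"
      and "\<not> (S \<subseteq> laurent_x \<and> T \<subseteq> laurent_x)" "\<not> (S \<subseteq> laurent_inv_x \<and> T \<subseteq> laurent_inv_x)" for S T
    using witness[OF that(1)] witness[OF that(2)]
  \<comment> \<open>Of the nine combinations, the two missing from \<open>undef\<close> put both
    classes inside \<open>laurent_x\<close> or both inside \<open>laurent_inv_x\<close>, which is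
    excluded.\<close>
  proof (elim disjE conjE)
    assume "S \<subseteq> laurent_x" "T \<subseteq> laurent_x"
    with that(3) show ?thesis by simp
  next
    assume "S \<subseteq> laurent_inv_x" "T \<subseteq> laurent_inv_x"
    with that(4) show ?thesis by simp
  qed (use undef in blast)+
  \<comment> \<open>Once the series product is rewritten through the matrix, the equation for
    \<gamma> is trivial and its definedness is that of (a) or (b).\<close>
  show ?thesis
    unfolding Let_def assms bl_times_defined_iff_mat_vec_defined bl_times_eq_mat_vec
  proof (intro conjI ballI allI impI, goal_cases)
    case (3 S T)
    then show ?case using fails by simp
  qed (auto intro: mat_vec_defined_laurent_x mat_vec_defined_laurent_inv_x)
qed

end
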